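(* Let $n\ge1$ and let $\Delta\subseteq B_n$ be any simplicial complex (a family of subsets of $[1,n]$ closed under taking subsets). Then there is a subcomplex $\Delta'\subseteq\Delta$ such that $f_i(\Delta')=f_i(\Delta)-f_{n-i}(\Delta)$ for $0\le i\le\lfloor\frac n2\rfloor$ and $f_i(\Delta')=0$ for $i>\lfloor\frac n2\rfloor$.
   Context: $B_n$ is the Boolean lattice of subsets of $[1,n]=\{1,\dots,n\}$. For a family $\Delta$ of subsets, $f_i(\Delta)$ is the number of sets of cardinality $i$ in $\Delta$. A subcomplex of $\Delta$ is a subfamily that is itself closed under taking subsets (possibly empty). *)

theory Defs
  imports Main
begin

definition simplicial_complex_on :: "nat \<Rightarrow> nat set set \<Rightarrow> bool" where
  "simplicial_complex_on n \<Delta> \<longleftrightarrow>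
     \<Delta> \<subseteq> Pow {1..n} \<and> (\<forall>S\<in>\<Delta>. \<forall>T. T \<subseteq> S \<longrightarrow> T \<in> \<Delta>)"

definition subcomplex :: "nat set set \<Rightarrow> nat set set \<Rightarrow> bool" where
  "subcomplex \<Delta>' \<Delta> \<longleftrightarrow> \<Delta>' \<subseteq> \<Delta> \<and> (\<forall>S\<in>\<Delta>'. \<forall>T. T \<subseteq> S \<longrightarrow> T \<in> \<Delta>')"

definition fvec :: "nat set set \<Rightarrow> nat \<Rightarrow> nat" where
  "fvec \<Delta> i = card {S \<in> \<Delta>. card S = i}"

end

theory Submission
  imports Defs "HOL-Computational_Algebra.Polynomial" "HOL-Library.Nat_Bijection"
begin

text \<open>
  Consider the graded algebra with generators \<open>x\<^sub>1, \<dots>, x\<^sub>n\<close> and relations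
  \<open>x\<^sub>j\<^sup>2 = \<lambda> x\<^sub>j \<omega>\<close>, where \<open>\<omega> = x\<^sub>1 + \<dots> + x\<^sub>n\<close> and
  \<open>\<lambda>\<close> is a parameter. Its low degrees have the squarefree monomials as a basis. With
  \<open>y\<^sub>j = x\<^sub>j - \<lambda> \<omega>\<close> we have \<open>x\<^sub>j y\<^sub>j = 0\<close>. Let \<open>I\<close> be the ideal
  spanned by the monomials of nonfaces and \<open>K\<close> the ideal spanned by the products of
  \<open>y\<^sub>t\<close> over the complements of faces. In degree \<open>i \<le> n/2\<close>, the spanning
  \<open>y\<close>-products, one for each face of cardinality \<open>n - i\<close>, are linearly independent modulo
  \<open>I\<close>: at \<open>\<lambda> = 1/i\<close> their coefficients on the \<open>i\<close>-faces become, up to a nonzero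
  factor, the inclusion matrix of \<open>i\<close>-sets in \<open>(n - i)\<close>-sets. As \<open>\<lambda>\<close> tends to \<open>0\<close>, the
  relations degenerate to \<open>x\<^sub>j\<^sup>2 = 0\<close>, so \<open>I + K\<close> degenerates to an ideal of the
  squarefree algebra. The faces that are not initial monomials of that limit form the
  required subcomplex.
\<close>

section \<open>Linear algebra over domains and specialization of polynomials\<close>

text \<open>Fraction-free Gaussian elimination: a homogeneous system with more unknowns than
  equations is reduced by one equation and one unknown at a time, multiplying by the pivot instead
  of dividing.\<close>

lemma nontrivial_solution:
  fixes M :: "'p \<Rightarrow> 'x \<Rightarrow> 'a::idom"
  assumes "finite X" "finite P" "card X < card P"
  shows "\<exists>c. (\<exists>p\<in>P. c p \<noteq> 0) \<and> (\<forall>x\<in>X. (\<Sum>p\<in>P. c p * M p x) = 0)"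
  using assms
proof (induction X arbitrary: P M rule: finite_induct)
  case empty
  then show ?case by (intro exI[of _ "\<lambda>_. 1"]) (auto simp: card_gt_0_iff)
next
  case (insert x0 X)
  show ?case
  proof (cases "\<forall>p\<in>P. M p x0 = 0")
    case True
    have "card X < card P" using insert by auto
    from insert.IH[OF insert.prems(1) this, of M] True show ?thesis
      by (auto intro!: sum.neutral)
  next
    case False
    then obtain q where q: "q \<in> P" "M q x0 \<noteq> 0" by auto
    define N where "N p x = M q x0 * M p x - M p x0 * M q x" for p x
    have "card X < card (P - {q})" using insert q by (auto simp: card_Diff_singleton)
    from insert.IH[OF _ this, of N] insert.prems obtain c where
      c: "\<exists>p\<in>P - {q}. c p \<noteq> 0" "\<And>x. x \<in> X \<Longrightarrow> (\<Sum>p\<in>P - {q}. c p * N p x) = 0"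
      by auto
    \<comment> \<open>The value at \<open>q\<close> is forced by equation \<open>x0\<close>; the
      factor \<open>M q x0\<close> keeps the other values nonzero, as there are no zero
      divisors.\<close>
    define e where "e p = (if p = q then - (\<Sum>p\<in>P - {q}. c p * M p x0) else c p * M q x0)" for p
    have split: "(\<Sum>p\<in>P. e p * M p x) = (\<Sum>p\<in>P - {q}. c p * N p x)" for x
    proof -
      have "(\<Sum>p\<in>P. e p * M p x) = e q * M q x + (\<Sum>p\<in>P - {q}. e p * M p x)"
        using insert.prems(1) q(1) by (rule sum.remove)
      also have "(\<Sum>p\<in>P - {q}. e p * M p x) = (\<Sum>p\<in>P - {q}. c p * M q x0 * M p x)"
        by (intro sum.cong) (auto simp: e_def)
      finally show ?thesis
        by (simp add: e_def N_def algebra_simps sum_subtractf sum_distrib_left sum_distrib_right)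
    qed
    have "(\<Sum>p\<in>P - {q}. c p * N p x0) = 0" by (simp add: N_def mult.commute)
    moreover have "\<exists>p\<in>P. e p \<noteq> 0" using c(1) q by (auto simp: e_def)
    ultimately show ?thesis using split c(2) by (intro exI[of _ e]) auto
  qed
qed

text \<open>The exponent \<open>d\<close> is the least order of vanishing at \<open>a\<close> among
  the nonzero entries, so an entry attaining it keeps a nonzero value at \<open>a\<close> after
  division.\<close>

lemma common_root_factor:
  fixes v :: "'x \<Rightarrow> 'a::idom poly"
  assumes "finite X" "\<exists>x\<in>X. v x \<noteq> 0"
  obtains d w where "\<And>x. x \<in> X \<Longrightarrow> v x = [:- a, 1:] ^ d * w x" "\<exists>x\<in>X. poly (w x) a \<noteq> 0"
proof -
  define R where "R = (\<lambda>x. order a (v x)) ` {x \<in> X. v x \<noteq> 0}"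
  define d where "d = Min R"
  have R: "finite R" "R \<noteq> {}" using assms by (auto simp: R_def)
  have "\<exists>w. v x = [:- a, 1:] ^ d * w" if "x \<in> X" for x
  proof (cases "v x = 0")
    case False
    then have "d \<le> order a (v x)" unfolding d_def using R that by (intro Min_le) (auto simp: R_def)
    then have "[:- a, 1:] ^ d dvd v x"
      by (meson dvd_trans le_imp_power_dvd order_1)
    then show ?thesis by (auto simp: dvd_def)
  qed (auto intro: exI[of _ 0])
  then obtain w where w: "\<And>x. x \<in> X \<Longrightarrow> v x = [:- a, 1:] ^ d * w x" by metis
  have "d \<in> R" unfolding d_def using R by (rule Min_in)
  then obtain x where x: "x \<in> X" "v x \<noteq> 0" "order a (v x) = d" by (auto simp: R_def)
  have "poly (w x) a \<noteq> 0"
  proof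
    assume "poly (w x) a = 0"
    then obtain u where "w x = [:- a, 1:] * u" by (auto simp: poly_eq_0_iff_dvd dvd_def)
    then have "v x = [:- a, 1:] ^ Suc d * u" using w[OF x(1)] by (simp only: power_Suc mult_ac)
    then show False using order_2[OF x(2), of a] x(3) by (metis dvd_triv_left)
  qed
  with w x(1) that show ?thesis by blast
qed

text \<open>A nontrivial relation, divided by the largest common power of \<open>[:- a, 1:]\<close>,
  stays nontrivial when evaluated at \<open>a\<close>.\<close>

lemma independent_if_specialization_independent:
  fixes M :: "'p \<Rightarrow> 'x \<Rightarrow> 'a::idom poly"
  assumes "finite P"
    and indep: "\<And>b. (\<And>x. x \<in> X \<Longrightarrow> (\<Sum>p\<in>P. b p * poly (M p x) a) = 0) \<Longrightarrow> \<forall>p\<in>P. b p = 0"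
    and zero: "\<And>x. x \<in> X \<Longrightarrow> (\<Sum>p\<in>P. c p * M p x) = 0"
  shows "\<forall>p\<in>P. c p = 0"
proof (rule ccontr)
  assume "\<not> ?thesis"
  with common_root_factor[OF assms(1), of c a] obtain d e where
    e: "\<And>p. p \<in> P \<Longrightarrow> c p = [:- a, 1:] ^ d * e p" "\<exists>p\<in>P. poly (e p) a \<noteq> 0" by auto
  have "(\<Sum>p\<in>P. poly (e p) a * poly (M p x) a) = 0" if "x \<in> X" for x
  proof -
    have "[:- a, 1:] ^ d * (\<Sum>p\<in>P. e p * M p x) = 0"
      using zero[OF that] e(1) by (simp add: sum_distrib_left mult.assoc)
    then have "poly (\<Sum>p\<in>P. e p * M p x) a = 0" by simp
    then show ?thesis by (simp add: poly_sum)
  qed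
  from indep[OF this] e(2) show False by blast
qed

section \<open>Inclusion matrices of complementary ranks\<close>

text \<open>Inclusion-exclusion turns the vanishing sums over all \<open>H\<close> containing a
  small set into vanishing sums over all \<open>H\<close> avoiding a small set. Avoiding
  \<open>V - H0\<close>, which has only \<open>i\<close> elements, singles out
  \<open>H0\<close>.\<close>

lemma inclusion_matrix_injective:
  fixes b :: "nat set \<Rightarrow> 'a::{idom,ring_char_0}"
  assumes "\<And>H. H \<in> P \<Longrightarrow> H \<subseteq> V \<and> card H = k" and "finite V" and "i + k = card V" "i \<le> k"
    and zero: "\<And>S. S \<subseteq> V \<Longrightarrow> card S = i \<Longrightarrow> (\<Sum>H | H \<in> P \<and> S \<subseteq> H. b H) = 0"
    and "H0 \<in> P"
  shows "b H0 = 0"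
proof -
  define f where "f S A = (\<Sum>H | H \<in> P \<and> S \<subseteq> H \<and> H \<inter> A = {}. b H)" for S A
  have finV: "finite S" if "S \<subseteq> V" for S using that assms(2) finite_subset by blast
  have finP: "finite P" by (rule finite_subset[of _ "Pow V"]) (use assms in auto)
  text \<open>Double counting extends the hypothesis from cardinality \<open>i\<close> to smaller sets.\<close>
  have f0: "f S {} = 0" if "S \<subseteq> V" "card S = i - m" for S m
    using that
  proof (induction m arbitrary: S)
    case 0
    then show ?case using zero by (simp add: f_def)
  next
    case (Suc m)
    show ?case
    proof (cases "i - Suc m = i - m")
      case True
      then show ?thesis using Suc by metis
    next
      case False
      then have card: "card (insert x S) = i - m" if "x \<in> V - S" for x
        using that Suc.prems finV by auto
      have "0 = (\<Sum>x\<in>V - S. f (insert x S) {})"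
        using Suc card by (intro sum.neutral[symmetric]) auto
      also have "\<dots> = (\<Sum>x\<in>V - S. \<Sum>H\<in>P. if insert x S \<subseteq> H then b H else 0)"
        using finP by (simp add: f_def sum.inter_filter)
      also have "\<dots> = (\<Sum>H\<in>P. \<Sum>x\<in>V - S. if insert x S \<subseteq> H then b H else 0)"
        by (rule sum.swap)
      also have "\<dots> = (\<Sum>H\<in>P. if S \<subseteq> H then of_nat (k - card S) * b H else 0)"
      proof (intro sum.cong refl)
        fix H assume H: "H \<in> P"
        have "(\<Sum>x\<in>V - S. if insert x S \<subseteq> H then b H else 0) = of_nat (card {x \<in> V - S. insert x S \<subseteq> H}) * b H"
          using assms(2) by (simp add: sum.inter_filter[symmetric])
        moreover have "{x \<in> V - S. insert x S \<subseteq> H} = (if S \<subseteq> H then H - S else {})"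
          using assms(1)[OF H] by auto
        moreover have "card (H - S) = k - card S" if "S \<subseteq> H"
          using that assms(1)[OF H] finV[OF Suc.prems(1)] by (simp add: card_Diff_subset)
        ultimately show "(\<Sum>x\<in>V - S. if insert x S \<subseteq> H then b H else 0) =
            (if S \<subseteq> H then of_nat (k - card S) * b H else 0)" by auto
      qed
      also have "\<dots> = of_nat (k - card S) * f S {}"
        using finP by (auto simp: f_def sum_distrib_left sum.inter_filter intro!: sum.cong)
      finally have "of_nat (k - card S) * f S {} = 0" by simp
      \<comment> \<open>Here \<open>card S < i \<le> k\<close>, and characteristic 0 keeps the
        multiplicity nonzero.\<close>
      moreover have "k - card S \<noteq> 0" using Suc.prems False assms(4) by auto
      ultimately show ?thesis by (metis mult_eq_0_iff of_nat_eq_0_iff)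
    qed
  qed
  have f: "f S A = 0" if "finite A" "A \<subseteq> V" "S \<subseteq> V" "S \<inter> A = {}" "card S + card A \<le> i" for S A
    using that
  proof (induction A arbitrary: S rule: finite_induct)
    case empty
    then show ?case using f0[of S "i - card S"] by simp
  next
    case (insert x A)
    have "f S A = f (insert x S) A + f S (insert x A)"
    proof -
      have "{H \<in> P. S \<subseteq> H \<and> H \<inter> A = {}} =
          {H \<in> P. insert x S \<subseteq> H \<and> H \<inter> A = {}} \<union> {H \<in> P. S \<subseteq> H \<and> H \<inter> insert x A = {}}" by auto
      then show ?thesis unfolding f_def using finP by (simp, subst sum.union_disjoint) auto
    qed
    moreover have "f S A = 0" using insert by (intro insert.IH) auto
    moreover have "f (insert x S) A = 0"
      using insert finV[of S] by (intro insert.IH) auto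
    ultimately show ?case by simp
  qed
  have H0: "H0 \<subseteq> V" "card H0 = k" using assms by auto
  have "{H. H \<in> P \<and> H \<inter> (V - H0) = {}} = {H0}"
  proof -
    have "H = H0" if "H \<in> P" "H \<inter> (V - H0) = {}" for H
      using that assms(1)[of H] H0 finV[of H0] by (intro card_subset_eq) auto
    then show ?thesis using \<open>H0 \<in> P\<close> by auto
  qed
  then have "f {} (V - H0) = b H0" by (simp add: f_def)
  moreover have "card (V - H0) = i" using H0 finV assms(3) by (simp add: card_Diff_subset)
  ultimately show ?thesis using f[of "V - H0" "{}"] assms(2) by auto
qed

section \<open>The coefficients \<open>kappa\<close>\<close>

text \<open>
  Up to normalization, \<open>kappa \<lambda> i r\<close> is the coefficient of \<open>x\<^sub>G\<close> in \<open>y\<^sub>T\<close> when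
  \<open>G\<close> and \<open>T\<close> have \<open>i\<close> elements and \<open>T - G\<close> has \<open>r\<close>.
\<close>

definition kappa :: "'a::comm_ring_1 \<Rightarrow> nat \<Rightarrow> nat \<Rightarrow> 'a" where
  "kappa x i r = (\<Prod>l=1..r. - of_nat l * x) * (\<Prod>l=Suc r..i. 1 - of_nat l * x)"

lemma poly_kappa: "poly (kappa p i r) a = kappa (poly p a) i r"
  by (simp add: kappa_def poly_prod)

text \<open>The two products differ only in the factor at \<open>l = Suc r\<close>, which is
  \<open>1 - l x\<close> on one side and \<open>- l x\<close> on the other.\<close>

lemma kappa_Suc:
  "r < i \<Longrightarrow> (1 - of_nat (Suc r) * x) * kappa x i (Suc r) = - (of_nat (Suc r) * x) * kappa x i r"
  by (simp add: kappa_def prod.atLeast_Suc_atMost[of "Suc r"] algebra_simps del: of_nat_Suc)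

lemma kappa_Suc_left: "r \<le> i \<Longrightarrow> kappa x (Suc i) r = (1 - of_nat (Suc i) * x) * kappa x i r"
  by (simp add: kappa_def algebra_simps del: of_nat_Suc)

lemma kappa_diag: "kappa x (Suc i) (Suc i) = - (of_nat (Suc i) * x) * kappa x i i"
  by (simp add: kappa_def algebra_simps del: of_nat_Suc)

text \<open>At \<open>1/i\<close> the factor \<open>l = i\<close> of the second product vanishes;
  for \<open>r = i\<close> that product is empty.\<close>

lemma kappa_inverse_eq_0:
  fixes i :: nat
  assumes "r < i" shows "kappa (inverse (of_nat i) :: 'a::field_char_0) i r = 0"
proof -
  have "(\<Prod>l=Suc r..i. 1 - of_nat l * inverse (of_nat i) :: 'a) = 0"
    using assms by (intro prod_zero bexI[of _ i]) auto
  then show ?thesis by (simp add: kappa_def)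
qed

lemma kappa_inverse_neq_0: "kappa (inverse (of_nat i) :: 'a::field_char_0) i i \<noteq> 0"
  by (cases "i = 0") (auto simp: kappa_def)

text \<open>The left side is the coordinate at \<open>Q\<close> of the vertex multiple by
  \<open>j \<in> Q - T\<close>, with \<open>a = card (T - Q)\<close>. For \<open>a < i\<close> the
  two sides differ by an instance of \<open>kappa_Suc\<close>.\<close>

lemma kappa_difference:
  fixes x :: "'a::comm_ring_1"
  assumes "a \<le> i"
  shows "(1 - of_nat (i - a) * x) * kappa x i a + of_nat (i - a) * x * kappa x i (Suc a)
    = kappa x (Suc i) a - kappa x (Suc i) (Suc a)"
proof (cases "a = i")
  case True
  then show ?thesis by (simp add: kappa_Suc_left kappa_diag algebra_simps)
next
  case False
  then have "a < i" using assms by simp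
  then have n: "of_nat (i - a) = (of_nat i - of_nat a :: 'a)" by (simp add: of_nat_diff)
  from \<open>a < i\<close> have "kappa x (Suc i) a - kappa x (Suc i) (Suc a)
      = (1 - of_nat (Suc i) * x) * (kappa x i a - kappa x i (Suc a))"
    by (simp add: kappa_Suc_left algebra_simps)
  moreover have "(1 - of_nat (i - a) * x) * kappa x i a + of_nat (i - a) * x * kappa x i (Suc a)
      - (1 - of_nat (Suc i) * x) * (kappa x i a - kappa x i (Suc a))
      = (1 - of_nat (Suc a) * x) * kappa x i (Suc a) - (- (of_nat (Suc a) * x) * kappa x i a)"
    by (simp add: n algebra_simps)
  ultimately show ?thesis using kappa_Suc[OF \<open>a < i\<close>, of x] by simp
qed

text \<open>Removing \<open>k\<close> from \<open>Q\<close> enlarges \<open>T - Q\<close> exactly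
  when \<open>k \<in> T\<close>.\<close>

lemma sum_kappa_remove:
  assumes "finite T" "finite Q"
  shows "(\<Sum>k\<in>Q. kappa x i (card (T - (Q - {k}))))
    = of_nat (card (Q \<inter> T)) * kappa x i (Suc (card (T - Q))) + of_nat (card (Q - T)) * kappa x i (card (T - Q))"
proof -
  have "(\<Sum>k\<in>Q. kappa x i (card (T - (Q - {k})))) =
    (\<Sum>k\<in>Q \<inter> T. kappa x i (card (T - (Q - {k})))) + (\<Sum>k\<in>Q - T. kappa x i (card (T - (Q - {k}))))"
    using assms(2) by (rule sum.Int_Diff)
  also have "(\<Sum>k\<in>Q \<inter> T. kappa x i (card (T - (Q - {k})))) = (\<Sum>k\<in>Q \<inter> T. kappa x i (Suc (card (T - Q))))"
  proof (intro sum.cong refl)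
    fix k assume "k \<in> Q \<inter> T"
    then have "T - (Q - {k}) = insert k (T - Q)" by auto
    then show "kappa x i (card (T - (Q - {k}))) = kappa x i (Suc (card (T - Q)))"
      using \<open>k \<in> Q \<inter> T\<close> assms by simp
  qed
  also have "(\<Sum>k\<in>Q - T. kappa x i (card (T - (Q - {k})))) = (\<Sum>k\<in>Q - T. kappa x i (card (T - Q)))"
  proof (intro sum.cong refl)
    fix k assume "k \<in> Q - T"
    then have "T - (Q - {k}) = T - Q" by auto
    then show "kappa x i (card (T - (Q - {k}))) = kappa x i (card (T - Q))" by simp
  qed
  finally show ?thesis by simp
qed

lemma sum_kappa_insert:
  assumes "finite V" "T \<subseteq> V" "Q \<subseteq> V"
  shows "(\<Sum>k\<in>V - T. kappa x i (card (insert k T - Q)))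
    = of_nat (card (Q - T)) * kappa x i (card (T - Q)) + of_nat (card (V - (T \<union> Q))) * kappa x i (Suc (card (T - Q)))"
proof -
  have fin: "finite T" "finite Q" using assms finite_subset by blast+
  have "(\<Sum>k\<in>V - T. kappa x i (card (insert k T - Q))) =
    (\<Sum>k\<in>(V - T) \<inter> Q. kappa x i (card (insert k T - Q))) + (\<Sum>k\<in>(V - T) - Q. kappa x i (card (insert k T - Q)))"
    using assms(1) by (intro sum.Int_Diff) auto
  also have "(\<Sum>k\<in>(V - T) \<inter> Q. kappa x i (card (insert k T - Q))) = (\<Sum>k\<in>(V - T) \<inter> Q. kappa x i (card (T - Q)))"
    by (intro sum.cong refl) (simp add: insert_Diff_if)
  also have "(V - T) \<inter> Q = Q - T" using assms by auto
  also have "(\<Sum>k\<in>(V - T) - Q. kappa x i (card (insert k T - Q))) = (\<Sum>k\<in>(V - T) - Q. kappa x i (Suc (card (T - Q))))"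
    using fin by (intro sum.cong refl) (simp add: insert_Diff_if)
  also have "(V - T) - Q = V - (T \<union> Q)" by auto
  finally show ?thesis by simp
qed

section \<open>Multiplication by a vertex in coordinates\<close>

text \<open>
  Multiplication by \<open>x\<^sub>j\<close> from degree \<open>i\<close> to degree \<open>i + 1\<close> in coordinates. For
  \<open>j \<in> G\<close> the relations give \<open>x\<^sub>j x\<^sub>G = \<lambda> \<omega> x\<^sub>G\<close>, hence
  \<open>(1 - i \<lambda>) x\<^sub>j x\<^sub>G = \<lambda> \<Sum>\<^bsub>k \<notin> G\<^esub> x\<^bsub>G \<union> {k}\<^esub>\<close>; the factor
  \<open>1 - i \<lambda>\<close> is multiplied in to keep the coefficients polynomial.
\<close>

definition vertex_mult :: "'a::comm_ring_1 \<Rightarrow> nat \<Rightarrow> 'b \<Rightarrow> ('b set \<Rightarrow> 'a) \<Rightarrow> 'b set \<Rightarrow> 'a" where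
  "vertex_mult x i j v Q =
    (if j \<in> Q then (1 - of_nat i * x) * v (Q - {j}) + x * (\<Sum>k\<in>Q - {j}. v (Q - {k})) else 0)"

lemma card_Diff_swap:
  assumes "finite T" "finite Q" "card T = i" "card Q = Suc i"
  shows "card (Q - T) = Suc (card (T - Q))" "card (Q \<inter> T) + card (T - Q) = i"
  using card_Int_Diff[of T Q] card_Int_Diff[of Q T] assms by (auto simp: Int_commute)

text \<open>Coordinate form of \<open>x_j y_T = 0\<close> for \<open>j \<in> T\<close>, a
  consequence of \<open>x_j y_j = 0\<close>.\<close>

lemma vertex_mult_kappa_mem:
  assumes "finite T" "finite Q" "card T = i" "card Q = Suc i" "j \<in> T"
  shows "vertex_mult x i j (\<lambda>G. kappa x i (card (T - G))) Q = 0"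
proof (cases "j \<in> Q")
  case True
  define a where "a = card (T - Q)"
  have c: "card (Q - T) = Suc a" "card (Q \<inter> T) = i - a" "a \<le> i"
    using card_Diff_swap[OF assms(1-4)] by (auto simp: a_def)
  have "card (Q \<inter> T) \<noteq> 0" using True assms by auto
  then have "a < i" using c by simp
  have "T - (Q - {j}) = insert j (T - Q)" using True assms by auto
  then have j: "card (T - (Q - {j})) = Suc a" using True assms by (simp add: a_def)
  have "(\<Sum>k\<in>Q. kappa x i (card (T - (Q - {k})))) =
      kappa x i (Suc a) + (\<Sum>k\<in>Q - {j}. kappa x i (card (T - (Q - {k}))))"
    using True assms j by (simp add: sum.remove)
  then have sum: "(\<Sum>k\<in>Q - {j}. kappa x i (card (T - (Q - {k})))) =
      (of_nat i - of_nat a) * kappa x i (Suc a) + of_nat (Suc a) * kappa x i a - kappa x i (Suc a)"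
    using sum_kappa_remove[OF assms(1,2), of x i] c by (simp add: a_def of_nat_diff algebra_simps)
  have "vertex_mult x i j (\<lambda>G. kappa x i (card (T - G))) Q =
      (1 - of_nat (Suc a) * x) * kappa x i (Suc a) - (- (of_nat (Suc a) * x) * kappa x i a)"
    by (simp only: vertex_mult_def True if_True j sum) (simp add: algebra_simps)
  then show ?thesis using kappa_Suc[OF \<open>a < i\<close>, of x] by simp
qed (simp add: vertex_mult_def)

text \<open>Coordinate form of \<open>x_j y_T = y_j y_T + \<lambda> \<omega> y_T\<close>. Summing
  \<open>y_k y_T\<close> over \<open>k\<close> outside \<open>T\<close> gives
  \<open>c \<omega> y_T\<close>, since \<open>x_k y_T = 0\<close> for \<open>k\<close> in
  \<open>T\<close>; multiplying by \<open>c\<close> therefore eliminates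
  \<open>\<omega>\<close>.\<close>

lemma vertex_mult_kappa_not_mem:
  fixes x :: "'a::comm_ring_1"
  assumes "finite V" "T \<subseteq> V" "Q \<subseteq> V" "card T = i" "card Q = Suc i" "j \<in> V - T"
  defines "c \<equiv> 1 - of_nat (card V - i) * x"
  shows "c * vertex_mult x i j (\<lambda>G. kappa x i (card (T - G))) Q =
    c * kappa x (Suc i) (card (insert j T - Q)) + x * (\<Sum>k\<in>V - T. kappa x (Suc i) (card (insert k T - Q)))"
proof -
  have fin: "finite T" "finite Q" using assms finite_subset by blast+
  define a where "a = card (T - Q)"
  have card: "card (Q - T) = Suc a" "card (Q \<inter> T) = i - a" "a \<le> i"
    using card_Diff_swap[OF fin assms(4,5)] by (auto simp: a_def)
  have "card V = card (T \<union> Q) + card (V - (T \<union> Q))"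
    using assms fin by (metis Un_least card_Diff_subset card_mono finite_Un le_add_diff_inverse)
  moreover have "T \<union> Q = T \<union> (Q - T)" by auto
  then have "card (T \<union> Q) = i + Suc a"
    using fin assms(4) card(1) by (metis Diff_disjoint card_Un_disjoint finite_Diff)
  ultimately have V: "of_nat (card V - i) = (of_nat (Suc a) + of_nat (card (V - (T \<union> Q))) :: 'a)"
    by (metis add.assoc add_diff_cancel_left' of_nat_add)
  have "c * kappa x (Suc i) (Suc a) + x * (\<Sum>k\<in>V - T. kappa x (Suc i) (card (insert k T - Q)))
      = (1 - of_nat (Suc a) * x) * kappa x (Suc i) (Suc a) - (- (of_nat (Suc a) * x) * kappa x (Suc i) a)"
    using sum_kappa_insert[OF assms(1-3), of x "Suc i"]
    by (simp add: c_def V card a_def[symmetric] algebra_simps)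
  \<comment> \<open>This evaluates the \<open>\<omega>\<close> term at \<open>Q\<close>; for
    \<open>j\<close> outside \<open>Q\<close> it cancels the first summand on the right.\<close>
  then have zero: "x * (\<Sum>k\<in>V - T. kappa x (Suc i) (card (insert k T - Q))) = - c * kappa x (Suc i) (Suc a)"
    using kappa_Suc[of a "Suc i" x] card(3) by (simp add: add_eq_0_iff)
  show ?thesis
  proof (cases "j \<in> Q")
    case True
    have j: "T - (Q - {j}) = T - Q" "insert j T - Q = T - Q" using True assms by auto
    have "(\<Sum>k\<in>Q. kappa x i (card (T - (Q - {k})))) =
        kappa x i a + (\<Sum>k\<in>Q - {j}. kappa x i (card (T - (Q - {k}))))"
      using True fin j by (simp add: sum.remove a_def)
    then have sum: "(\<Sum>k\<in>Q - {j}. kappa x i (card (T - (Q - {k})))) =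
        of_nat (i - a) * kappa x i (Suc a) + of_nat (Suc a) * kappa x i a - kappa x i a"
      using sum_kappa_remove[OF fin, of x i] card by (simp add: a_def algebra_simps)
    have mult: "vertex_mult x i j (\<lambda>G. kappa x i (card (T - G))) Q =
        (1 - of_nat (i - a) * x) * kappa x i a + of_nat (i - a) * x * kappa x i (Suc a)"
      using card(3)
      by (simp only: vertex_mult_def True if_True j a_def[symmetric] sum) (simp add: of_nat_diff algebra_simps)
    show ?thesis
      unfolding mult kappa_difference[OF card(3)] zero j a_def[symmetric] by (simp add: algebra_simps)
  next
    case False
    then have "card (insert j T - Q) = Suc a" using assms fin by (simp add: insert_Diff_if a_def)
    then show ?thesis using False zero by (simp add: vertex_mult_def)
  qed
qed

section \<open>The dual ideal and its limit at \<lambda> = 0\<close>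

locale complex_on =
  fixes n :: nat and \<Delta> :: "nat set set"
  assumes faces: "\<Delta> \<subseteq> Pow {1..n}"
    and down: "\<And>S T. S \<in> \<Delta> \<Longrightarrow> T \<subseteq> S \<Longrightarrow> T \<in> \<Delta>"
begin

definition faces_of_card :: "nat \<Rightarrow> nat set set" where
  "faces_of_card i = {S \<in> \<Delta>. card S = i}"

text \<open>Normalized coordinates of the product of the \<open>y_t\<close> over the complement of
  \<open>H\<close>, with the polynomial indeterminate as \<lambda>.\<close>

definition dual_vector :: "nat \<Rightarrow> nat set \<Rightarrow> nat set \<Rightarrow> real poly" where
  "dual_vector i H G = kappa [:0, 1:] i (card ({1..n} - H - G))"

text \<open>The degree \<open>i\<close> part of the ideal \<open>K\<close>; comparing coordinates
  only at faces amounts to working modulo \<open>I\<close>.\<close>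

definition dual_span :: "nat \<Rightarrow> (nat set \<Rightarrow> real poly) \<Rightarrow> bool" where
  "dual_span i v \<longleftrightarrow>
    (\<exists>b. \<forall>G\<in>faces_of_card i. v G = (\<Sum>H\<in>faces_of_card (n - i). b H * dual_vector i H G))"

text \<open>
  Evaluation at \<open>0\<close> is the limit \<open>\<lambda> \<rightarrow> 0\<close>; sets are ordered by their binary encoding.
\<close>

definition leads :: "nat \<Rightarrow> (nat set \<Rightarrow> real poly) \<Rightarrow> nat set \<Rightarrow> bool" where
  "leads i v S \<longleftrightarrow> poly (v S) 0 \<noteq> 0 \<and>
    (\<forall>G\<in>faces_of_card i. set_encode G < set_encode S \<longrightarrow> poly (v G) 0 = 0)"

text \<open>The power of the indeterminate saturates the span at 0: a vector that lies in it only
  after multiplication by a power of \<lambda> still contributes its limit, so the limit keeps the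
  full dimension.\<close>

definition initial_sets :: "nat \<Rightarrow> nat set set" where
  "initial_sets i =
    {S \<in> faces_of_card i. \<exists>d v. dual_span i (\<lambda>G. [:0, 1:] ^ d * v G) \<and> leads i v S}"

lemma finite_face: "S \<in> \<Delta> \<Longrightarrow> finite S"
  using faces finite_subset by blast

lemma finite_complex: "finite \<Delta>"
  using faces finite_subset by blast

lemma finite_faces_of_card [simp]: "finite (faces_of_card i)"
  using finite_complex by (simp add: faces_of_card_def)

lemma finite_initial_sets [simp]: "finite (initial_sets i)"
  by (simp add: initial_sets_def)

lemma set_encode_faces_inj:
  "S \<in> faces_of_card i \<Longrightarrow> G \<in> faces_of_card i \<Longrightarrow> set_encode G = set_encode S \<longleftrightarrow> G = S"
  by (auto simp: faces_of_card_def finite_face set_encode_eq)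

lemma dual_span_cong:
  "dual_span i v \<Longrightarrow> (\<And>G. G \<in> faces_of_card i \<Longrightarrow> w G = v G) \<Longrightarrow> dual_span i w"
  unfolding dual_span_def by auto

lemma dual_span_dual_vector:
  assumes "H \<in> faces_of_card (n - i)"
  shows "dual_span i (dual_vector i H)"
  unfolding dual_span_def
  using assms
  by (intro exI[of _ "\<lambda>K. if K = H then 1 else 0"]) (simp add: if_distrib[of "\<lambda>c. c * _"] cong: if_cong)

lemma dual_span_scale: "dual_span i v \<Longrightarrow> dual_span i (\<lambda>G. c * v G)"
proof -
  assume "dual_span i v"
  then obtain b where "\<forall>G\<in>faces_of_card i. v G = (\<Sum>H\<in>faces_of_card (n - i). b H * dual_vector i H G)"
    by (auto simp: dual_span_def)
  then show ?thesis unfolding dual_span_def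
    by (intro exI[of _ "\<lambda>H. c * b H"]) (simp add: sum_distrib_left mult.assoc)
qed

lemma dual_span_add:
  assumes "dual_span i v" "dual_span i w" shows "dual_span i (\<lambda>G. v G + w G)"
proof -
  from assms obtain b e where
    "\<forall>G\<in>faces_of_card i. v G = (\<Sum>H\<in>faces_of_card (n - i). b H * dual_vector i H G)"
    "\<forall>G\<in>faces_of_card i. w G = (\<Sum>H\<in>faces_of_card (n - i). e H * dual_vector i H G)"
    by (auto simp: dual_span_def)
  then show ?thesis unfolding dual_span_def
    by (intro exI[of _ "\<lambda>H. b H + e H"]) (simp add: sum.distrib algebra_simps)
qed

lemma dual_span_0: "dual_span i (\<lambda>G. 0)"
  unfolding dual_span_def by (intro exI[of _ "\<lambda>_. 0"]) simp

lemma dual_span_sum: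
  "(\<And>k. k \<in> A \<Longrightarrow> dual_span i (v k)) \<Longrightarrow> dual_span i (\<lambda>G. \<Sum>k\<in>A. v k G)"
  by (induction A rule: infinite_finite_induct) (auto simp: dual_span_0 dual_span_add)

section \<open>Independence and the number of initial sets\<close>

text \<open>At \<lambda> = \<open>1/i\<close> only the pairs with \<open>S \<subseteq> H\<close>
  survive, all with the same nonzero value, which leaves the inclusion matrix.\<close>

lemma dual_vector_independent:
  assumes "2 * i \<le> n"
    and "\<And>G. G \<in> faces_of_card i \<Longrightarrow> (\<Sum>H\<in>faces_of_card (n - i). b H * dual_vector i H G) = 0"
  shows "\<forall>H\<in>faces_of_card (n - i). b H = 0"
proof (rule independent_if_specialization_independent[where a = "inverse (real i)", OF _ _ assms(2)])
  fix b :: "nat set \<Rightarrow> real"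
  assume b: "\<And>G. G \<in> faces_of_card i \<Longrightarrow>
    (\<Sum>H\<in>faces_of_card (n - i). b H * poly (dual_vector i H G) (inverse (real i))) = 0"
  show "\<forall>H\<in>faces_of_card (n - i). b H = 0"
  proof
    fix H0 assume "H0 \<in> faces_of_card (n - i)"
    show "b H0 = 0"
    proof (rule inclusion_matrix_injective[where P = "faces_of_card (n - i)" and V = "{1..n}" and k = "n - i" and i = i])
      fix S assume S: "S \<subseteq> {1..n}" "card S = i"
      show "(\<Sum>H | H \<in> faces_of_card (n - i) \<and> S \<subseteq> H. b H) = 0"
      proof (cases "S \<in> \<Delta>")
        case True
        have vec: "poly (dual_vector i H S) (inverse (real i)) =
            (if S \<subseteq> H then kappa (inverse (real i)) i i else 0)" if "H \<in> faces_of_card (n - i)" for H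
        proof -
          have "card ({1..n} - H) = i" "finite H"
            using that assms(1) faces by (auto simp: faces_of_card_def finite_face card_Diff_subset)
          moreover have "card ({1..n} - H - S) < card ({1..n} - H)" if "\<not> S \<subseteq> H"
            using that S by (intro psubset_card_mono) auto
          moreover have "{1..n} - H - S = {1..n} - H" if "S \<subseteq> H" using that by auto
          ultimately show ?thesis by (auto simp: dual_vector_def poly_kappa kappa_inverse_eq_0)
        qed
        have "0 = (\<Sum>H\<in>faces_of_card (n - i). b H * poly (dual_vector i H S) (inverse (real i)))"
          using b True S by (simp add: faces_of_card_def)
        also have "\<dots> = (\<Sum>H | H \<in> faces_of_card (n - i) \<and> S \<subseteq> H. b H) * kappa (inverse (real i)) i i"
          by (auto simp: vec sum.inter_filter sum_distrib_right intro!: sum.cong)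
        finally show ?thesis using kappa_inverse_neq_0[of i, where 'a = real] by simp
      next
        case False
        \<comment> \<open>No face contains a nonface, so the equations at nonfaces hold as
          well.\<close>
        then have "{H. H \<in> faces_of_card (n - i) \<and> S \<subseteq> H} = {}"
          using down by (auto simp: faces_of_card_def)
        then show ?thesis by (simp only: sum.empty)
      qed
    qed (use assms(1) faces \<open>H0 \<in> _\<close> in \<open>auto simp: faces_of_card_def\<close>)
  qed
qed auto

text \<open>Dividing out the largest power of \<lambda> leaves a nonzero limit, and the least face
  in its support is initial.\<close>

lemma leads_exists:
  assumes "dual_span i v" "G \<in> faces_of_card i" "v G \<noteq> 0"
  shows "\<exists>S\<in>initial_sets i. v S \<noteq> 0"
proof -
  obtain d w where w: "\<And>G. G \<in> faces_of_card i \<Longrightarrow> v G = [:- 0, 1:] ^ d * w G"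
    "\<exists>G\<in>faces_of_card i. poly (w G) 0 \<noteq> 0"
    by (rule common_root_factor[of "faces_of_card i" v 0]) (use assms in auto)
  define C where "C = {G \<in> faces_of_card i. poly (w G) 0 \<noteq> 0}"
  define S where "S = arg_min_on set_encode C"
  have C: "finite C" "C \<noteq> {}" using w(2) by (auto simp: C_def)
  then have S: "S \<in> C" unfolding S_def by (rule arg_min_if_finite)
  have "poly (w G) 0 = 0" if "G \<in> faces_of_card i" "set_encode G < set_encode S" for G
    using arg_min_if_finite(2)[OF C, of set_encode] that by (auto simp: C_def S_def)
  with S have "leads i w S" by (auto simp: leads_def C_def)
  moreover have "dual_span i (\<lambda>G. [:0, 1:] ^ d * w G)"
    by (rule dual_span_cong[OF assms(1)]) (simp add: w(1))
  ultimately have "S \<in> initial_sets i" using S by (auto simp: initial_sets_def C_def)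
  moreover have "v S \<noteq> 0" using S w(1)[of S] by (auto simp: C_def)
  ultimately show ?thesis by blast
qed

text \<open>With fewer initial sets, a nontrivial combination of the independent dual vectors would
  vanish on all of them, against \<open>leads_exists\<close>.\<close>

lemma card_initial_sets_ge:
  assumes "2 * i \<le> n"
  shows "card (faces_of_card (n - i)) \<le> card (initial_sets i)"
proof (rule ccontr)
  assume "\<not> ?thesis"
  then obtain b where b: "\<exists>H\<in>faces_of_card (n - i). b H \<noteq> 0"
    "\<forall>G\<in>initial_sets i. (\<Sum>H\<in>faces_of_card (n - i). b H * dual_vector i H G) = 0"
    using nontrivial_solution[of "initial_sets i" "faces_of_card (n - i)" "dual_vector i"] by auto
  define v where "v G = (\<Sum>H\<in>faces_of_card (n - i). b H * dual_vector i H G)" for G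
  have "dual_span i v" by (auto simp: dual_span_def v_def)
  moreover obtain G where "G \<in> faces_of_card i" "v G \<noteq> 0"
    using dual_vector_independent[OF assms, of b] b(1) by (auto simp: v_def)
  ultimately obtain S where "S \<in> initial_sets i" "v S \<noteq> 0" using leads_exists by blast
  then show False using b(2) by (auto simp: v_def)
qed

text \<open>With more initial sets, vectors led by them would satisfy a relation that remains
  nontrivial at \<lambda> = 0, but distinct leading sets make their limits triangular.\<close>

lemma card_initial_sets_le: "card (initial_sets i) \<le> card (faces_of_card (n - i))"
proof (rule ccontr)
  assume less: "\<not> ?thesis"
  have "\<forall>S\<in>initial_sets i. \<exists>d v b. leads i v S \<and> (\<forall>G\<in>faces_of_card i.
      [:0, 1:] ^ d * v G = (\<Sum>H\<in>faces_of_card (n - i). b H * dual_vector i H G))"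
    by (auto simp: initial_sets_def dual_span_def)
  then obtain d v b where v: "\<And>S. S \<in> initial_sets i \<Longrightarrow> leads i (v S) S"
    "\<And>S G. S \<in> initial_sets i \<Longrightarrow> G \<in> faces_of_card i \<Longrightarrow>
      [:0, 1:] ^ d S * v S G = (\<Sum>H\<in>faces_of_card (n - i). b S H * dual_vector i H G)"
    by metis
  obtain c where c: "\<exists>S\<in>initial_sets i. c S \<noteq> 0"
    "\<forall>H\<in>faces_of_card (n - i). (\<Sum>S\<in>initial_sets i. c S * b S H) = 0"
    using nontrivial_solution[of "faces_of_card (n - i)" "initial_sets i" b] less by auto
  obtain e f where f: "\<And>S. S \<in> initial_sets i \<Longrightarrow> c S * [:0, 1:] ^ d S = [:- 0, 1:] ^ e * f S"
    "\<exists>S\<in>initial_sets i. poly (f S) 0 \<noteq> 0"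
    using common_root_factor[of "initial_sets i" "\<lambda>S. c S * [:0, 1:] ^ d S" 0] c(1) by auto
  have zero: "(\<Sum>S\<in>initial_sets i. f S * v S G) = 0" if G: "G \<in> faces_of_card i" for G
  proof -
    have "[:0, 1:] ^ e * (\<Sum>S\<in>initial_sets i. f S * v S G) =
        (\<Sum>S\<in>initial_sets i. c S * ([:0, 1:] ^ d S * v S G))"
      using f(1) by (simp add: sum_distrib_left mult.assoc[symmetric])
    also have "\<dots> = (\<Sum>S\<in>initial_sets i. \<Sum>H\<in>faces_of_card (n - i). c S * b S H * dual_vector i H G)"
      using v(2) G by (simp add: sum_distrib_left mult.assoc)
    also have "\<dots> = (\<Sum>H\<in>faces_of_card (n - i). (\<Sum>S\<in>initial_sets i. c S * b S H) * dual_vector i H G)"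
      by (subst sum.swap) (simp add: sum_distrib_right)
    finally show ?thesis using c(2) by simp
  qed
  define C where "C = {S \<in> initial_sets i. poly (f S) 0 \<noteq> 0}"
  \<comment> \<open>At the least leading set with nonzero coefficient, every other term of the
    relation vanishes in the limit.\<close>
  define S where "S = arg_min_on set_encode C"
  have C: "finite C" "C \<noteq> {}" using f(2) by (auto simp: C_def)
  then have S: "S \<in> C" unfolding S_def by (rule arg_min_if_finite)
  then have S': "S \<in> initial_sets i" "S \<in> faces_of_card i" "poly (f S) 0 \<noteq> 0"
    by (auto simp: C_def initial_sets_def)
  have others: "poly (f K * v K S) 0 = 0" if K: "K \<in> initial_sets i - {S}" for K
  proof (cases "poly (f K) 0 = 0")
    case False
    then have "\<not> set_encode K < set_encode S"
      using arg_min_if_finite(2)[OF C, of set_encode] K by (auto simp: C_def S_def)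
    moreover have "set_encode K \<noteq> set_encode S"
      using K S'(2) set_encode_faces_inj by (auto simp: initial_sets_def)
    ultimately have "poly (v K S) 0 = 0" using v(1)[of K] K S'(2) by (auto simp: leads_def)
    then show ?thesis by simp
  qed simp
  have "0 = poly (\<Sum>K\<in>initial_sets i. f K * v K S) 0" using zero S'(2) by simp
  also have "\<dots> = poly (f S * v S S) 0 + (\<Sum>K\<in>initial_sets i - {S}. poly (f K * v K S) 0)"
    by (simp only: poly_sum poly_add sum.remove[OF finite_initial_sets S'(1)])
  also have "(\<Sum>K\<in>initial_sets i - {S}. poly (f K * v K S) 0) = 0"
    using others by (intro sum.neutral) blast
  finally show False using S'(3) v(1)[OF S'(1)] by (simp add: leads_def)
qed

section \<open>Initial sets are closed upwards\<close>

text \<open>This makes the span an ideal: a generator goes to 0 or to a combination of the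
  generators of the sets \<open>H - {k}\<close>, which are again faces. The extra factor has value 1
  at \<lambda> = 0 and does not affect limits.\<close>

lemma dual_span_vertex_mult:
  assumes "i < n" "j \<in> {1..n}" "dual_span i v"
  shows "dual_span (Suc i) (\<lambda>Q. (1 - of_nat (n - i) * [:0, 1:]) * vertex_mult [:0, 1:] i j v Q)"
proof -
  let ?x = "[:0, 1:] :: real poly"
  let ?c = "1 - of_nat (n - i) * ?x"
  obtain b where b: "\<And>G. G \<in> faces_of_card i \<Longrightarrow>
      v G = (\<Sum>H\<in>faces_of_card (n - i). b H * dual_vector i H G)"
    using assms(3) by (auto simp: dual_span_def)
  have gen: "dual_span (Suc i) (\<lambda>Q. ?c * vertex_mult ?x i j (dual_vector i H) Q)"
    if H: "H \<in> faces_of_card (n - i)" for H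
  proof -
    define T where "T = {1..n} - H"
    have T: "T \<subseteq> {1..n}" "{1..n} - T = H" "card T = i"
      using H assms(1) faces by (auto simp: T_def faces_of_card_def finite_face card_Diff_subset)
    have u: "dual_vector i H = (\<lambda>G. kappa ?x i (card (T - G)))"
      by (rule ext) (simp only: dual_vector_def T_def)
    have Q: "Q \<subseteq> {1..n}" "card Q = Suc i" "finite Q" if "Q \<in> faces_of_card (Suc i)" for Q
      using that faces by (auto simp: faces_of_card_def finite_face)
    show ?thesis
    proof (cases "j \<in> T")
      case True
      show ?thesis
      proof (rule dual_span_cong[OF dual_span_0])
        fix Q assume "Q \<in> faces_of_card (Suc i)"
        then show "?c * vertex_mult ?x i j (dual_vector i H) Q = 0"
          using vertex_mult_kappa_mem[of T Q i j ?x] T True Q finite_subset[OF T(1)] unfolding u by auto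
      qed
    next
      case False
      have Hk: "H - {k} \<in> faces_of_card (n - Suc i)" if "k \<in> H" for k
        using that H down[of H "H - {k}"] by (auto simp: faces_of_card_def finite_face)
      have uk: "dual_vector (Suc i) (H - {k}) Q = kappa ?x (Suc i) (card (insert k T - Q))" if "k \<in> H" for k Q
      proof -
        have "{1..n} - (H - {k}) = insert k T" using that T(2) by (auto simp: T_def)
        then show ?thesis by (simp add: dual_vector_def)
      qed
      have j: "j \<in> H" using False assms(2) by (auto simp: T_def)
      have "dual_span (Suc i) (\<lambda>Q. ?c * dual_vector (Suc i) (H - {j}) Q + ?x * (\<Sum>k\<in>H. dual_vector (Suc i) (H - {k}) Q))"
        by (intro dual_span_add dual_span_scale dual_span_sum dual_span_dual_vector Hk j)
      then show ?thesis
      proof (rule dual_span_cong)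
        fix Q assume "Q \<in> faces_of_card (Suc i)"
        then show "?c * vertex_mult ?x i j (dual_vector i H) Q =
            ?c * dual_vector (Suc i) (H - {j}) Q + ?x * (\<Sum>k\<in>H. dual_vector (Suc i) (H - {k}) Q)"
          using vertex_mult_kappa_not_mem[of "{1..n}" T Q i j ?x] T Q False assms(2) j
          by (simp add: u uk)
      qed
    qed
  qed
  have "dual_span (Suc i) (\<lambda>Q. \<Sum>H\<in>faces_of_card (n - i). b H * (?c * vertex_mult ?x i j (dual_vector i H) Q))"
    by (intro dual_span_sum dual_span_scale gen)
  then show ?thesis
  proof (rule dual_span_cong)
    fix Q assume Q: "Q \<in> faces_of_card (Suc i)"
    \<comment> \<open>A face \<open>Q\<close> uses only values at its own subsets, so the
      unspecified values of \<open>v\<close> at nonfaces do not enter.\<close>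
    have v: "v (Q - {k}) = (\<Sum>H\<in>faces_of_card (n - i). b H * dual_vector i H (Q - {k}))" if "k \<in> Q" for k
      using Q that down[of Q "Q - {k}"] by (intro b) (auto simp: faces_of_card_def finite_face)
    have "vertex_mult ?x i j v Q = (\<Sum>H\<in>faces_of_card (n - i). b H * vertex_mult ?x i j (dual_vector i H) Q)"
    proof (cases "j \<in> Q")
      case True
      have "(\<Sum>k\<in>Q - {j}. v (Q - {k})) =
          (\<Sum>H\<in>faces_of_card (n - i). b H * (\<Sum>k\<in>Q - {j}. dual_vector i H (Q - {k})))"
        by (simp add: v sum_distrib_left sum.swap[of _ "Q - {j}"])
      then show ?thesis using True v[OF True]
        by (simp add: vertex_mult_def sum_distrib_left sum.distrib[symmetric] algebra_simps)
    qed (simp add: vertex_mult_def)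
    then show "?c * vertex_mult ?x i j v Q =
        (\<Sum>H\<in>faces_of_card (n - i). b H * (?c * vertex_mult ?x i j (dual_vector i H) Q))"
      by (simp add: sum_distrib_left mult.left_commute)
  qed
qed

text \<open>At \<lambda> = 0 multiplication by \<open>x_j\<close> just adds \<open>j\<close> to sets
  not containing it. This raises every encoding by \<open>2 ^ j\<close> and so preserves the
  order.\<close>

lemma initial_sets_insert:
  assumes "S \<in> initial_sets i" "insert j S \<in> \<Delta>" "j \<notin> S"
  shows "insert j S \<in> initial_sets (Suc i)"
proof -
  let ?x = "[:0, 1:] :: real poly"
  let ?c = "1 - of_nat (n - i) * ?x"
  obtain d v where S: "S \<in> \<Delta>" "card S = i" "finite S" "leads i v S"
    and span: "dual_span i (\<lambda>G. ?x ^ d * v G)"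
    using assms(1) by (auto simp: initial_sets_def faces_of_card_def finite_face)
  have j: "j \<in> {1..n}" "insert j S \<in> faces_of_card (Suc i)"
    using assms faces S by (auto simp: faces_of_card_def)
  have "card (insert j S) \<le> card {1..n}" using assms(2) faces by (intro card_mono) auto
  then have "i < n" using S assms(3) by simp
  define w where "w Q = ?c * vertex_mult ?x i j v Q" for Q
  have w0: "poly (w Q) 0 = (if j \<in> Q then poly (v (Q - {j})) 0 else 0)" for Q
    by (simp add: w_def vertex_mult_def)
  have "leads (Suc i) w (insert j S)"
    unfolding leads_def
  proof (intro conjI ballI impI)
    show "poly (w (insert j S)) 0 \<noteq> 0"
      using S(4) assms(3) by (simp add: w0 leads_def)
    fix Q assume Q: "Q \<in> faces_of_card (Suc i)" "set_encode Q < set_encode (insert j S)"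
    show "poly (w Q) 0 = 0"
    proof (cases "j \<in> Q")
      case True
      have fin: "finite Q" using Q by (auto simp: faces_of_card_def finite_face)
      have "set_encode Q = 2 ^ j + set_encode (Q - {j})"
        using set_encode_insert[of "Q - {j}" j] True fin by (simp add: insert_absorb)
      moreover have "set_encode (insert j S) = 2 ^ j + set_encode S"
        using S assms(3) by (simp add: set_encode_insert)
      moreover have "Q - {j} \<in> faces_of_card i"
        using Q True fin down[of Q "Q - {j}"] by (auto simp: faces_of_card_def)
      ultimately show ?thesis using S(4) Q(2) by (auto simp: w0 leads_def)
    qed (simp add: w0)
  qed
  moreover have "dual_span (Suc i) (\<lambda>Q. ?x ^ d * w Q)"
  proof (rule dual_span_cong[OF dual_span_vertex_mult[OF \<open>i < n\<close> j(1) span]])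
    fix Q show "?x ^ d * w Q = ?c * vertex_mult ?x i j (\<lambda>G. ?x ^ d * v G) Q"
      by (simp add: w_def vertex_mult_def sum_distrib_left algebra_simps)
  qed
  ultimately show ?thesis using j(2) by (auto simp: initial_sets_def)
qed

lemma initial_sets_superset:
  assumes "S \<in> initial_sets (card S)" "S \<subseteq> R" "R \<in> \<Delta>"
  shows "R \<in> initial_sets (card R)"
proof -
  have "finite (R - S)" using assms finite_face by blast
  then have "A \<subseteq> R - S \<Longrightarrow> S \<union> A \<in> initial_sets (card (S \<union> A))" for A
  proof (induction A rule: infinite_finite_induct)
    case (infinite A)
    then show ?case using finite_subset by blast
  next
    case empty
    then show ?case using assms by simp
  next
    case (insert j A)
    have "insert j (S \<union> A) \<in> \<Delta>" using assms insert.prems by (intro down[OF assms(3)]) auto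
    moreover have "finite (S \<union> A)" "j \<notin> S \<union> A"
      using assms insert finite_face[OF assms(3)] finite_subset by auto
    ultimately show ?case using initial_sets_insert[of "S \<union> A" _ j] insert by simp
  qed
  from this[of "R - S"] show ?thesis using assms(2) by (simp add: Un_absorb1)
qed

end

section \<open>The subcomplex of noninitial faces\<close>

theorem theorem11:
  fixes n :: nat and \<Delta> :: "nat set set"
  assumes "n \<ge> 1" and "simplicial_complex_on n \<Delta>"
  shows "\<exists>\<Delta>'. subcomplex \<Delta>' \<Delta> \<and>
           (\<forall>i. i \<le> n div 2 \<longrightarrow> int (fvec \<Delta>' i) = int (fvec \<Delta> i) - int (fvec \<Delta> (n - i))) \<and>
           (\<forall>i. i > n div 2 \<longrightarrow> fvec \<Delta>' i = 0)"
proof -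
  interpret complex_on n \<Delta>
    using assms(2) by unfold_locales (auto simp: simplicial_complex_on_def)
  define \<Gamma> where "\<Gamma> = {S \<in> \<Delta>. card S \<le> n div 2 \<and> S \<notin> initial_sets (card S)}"
  have "subcomplex \<Gamma> \<Delta>"
    unfolding subcomplex_def
  proof (intro conjI ballI allI impI)
    fix S T assume "S \<in> \<Gamma>" "T \<subseteq> S"
    moreover from this have "card T \<le> card S"
      by (auto simp: \<Gamma>_def finite_face intro: card_mono)
    ultimately show "T \<in> \<Gamma>"
      using initial_sets_superset[of T S] down[of S T] by (auto simp: \<Gamma>_def)
  qed (auto simp: \<Gamma>_def)
  moreover have "int (fvec \<Gamma> i) = int (fvec \<Delta> i) - int (fvec \<Delta> (n - i))" if "i \<le> n div 2" for i
  proof -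
    have sub: "initial_sets i \<subseteq> faces_of_card i" by (auto simp: initial_sets_def)
    have "{S \<in> \<Gamma>. card S = i} = faces_of_card i - initial_sets i"
      using that by (auto simp: \<Gamma>_def faces_of_card_def)
    then have "fvec \<Gamma> i = card (faces_of_card i) - card (initial_sets i)"
      using sub by (simp add: fvec_def card_Diff_subset)
    moreover have "card (initial_sets i) \<le> card (faces_of_card i)"
      using sub by (intro card_mono) auto
    \<comment> \<open>Both bounds apply because \<open>i \<le> n div 2\<close> gives
      \<open>2 * i \<le> n\<close>.\<close>
    moreover have "card (initial_sets i) = card (faces_of_card (n - i))"
      using card_initial_sets_le card_initial_sets_ge[of i] that by (intro antisym) auto
    ultimately show ?thesis by (simp add: fvec_def faces_of_card_def)
  qed
  moreover have "fvec \<Gamma> i = 0" if "i > n div 2" for i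
  proof -
    have "{S \<in> \<Gamma>. card S = i} = {}" using that by (auto simp: \<Gamma>_def)
    then show ?thesis by (simp only: fvec_def card.empty)
  qed
  ultimately show ?thesis by blast
qed

end
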